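(* Let $\nu_0^1$ be a probability measure on $\mathcal{K}_0^1$ such that the pushforward $(\alpha_0)_*\nu_0^1$ has uniform distribution (on $[\frac12,1)$), let $\nu_0:=(\Phi_4)_*(\nu_0^1\otimes\nu)$ where $\nu$ is a probability measure on $(0,\infty)$, and let $\Phi$ be the distribution function of the standard normal distribution. For $\nu_0$-measurable sets $\mathcal{A}\subset\mathcal{K}_0$ put $$p(\mathcal{A}):=\frac{1}{\sqrt{2\pi\sigma^2}}\int_{K'\in\mathcal{A}}\exp\left(-\frac{\left(\delta^h\left(B_E,\frac{\alpha_0(K')}{(\Phi_4^{-1}(K'))_2}K'\right)\right)^2}{2\sigma^2}\right)\mathrm{d}\nu_0(K').$$ Then $$P(\mathcal{A}):=\frac{4p(\mathcal{A})}{\Phi\left(\frac1\sigma\right)-\Phi(0)}=\frac{4}{\left(\Phi\left(\frac1\sigma\right)-\Phi(0)\right)\sqrt{2\pi\sigma^2}}\int_{K'\in\mathcal{A}}\exp\left(-\frac{\left(\delta^h\left(B_E,\frac{\alpha_0(K')}{(\Phi_4^{-1}(K'))_2}K'\right)\right)^2}{2\sigma^2}\right)\mathrm{d}\nu_0(K')$$ is a probability measure on $\mathcal{K}_0$. Moreover, the pushforward $(\alpha_0)_*P$ has truncated normal distribution on the interval $[\frac12,1)$ (with mean $\frac12$ and variance $\left(\frac{\sigma}{2}\right)^2$), so $$(\alpha_0)_*P\left(\left\{\tfrac12\le t\le c\right\}\right)=P\left(\{K\in\mathcal{K}_0 \mid \alpha_0(K)\le c\}\right)=\frac{\Phi\l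eft(\frac{c-\frac12}{\frac{\sigma}{2}}\right)-\Phi(0)}{\Phi\left(\frac1\sigma\right)-\Phi(0)}.$$
   Context: $V$ is a real $n$-dimensional Euclidean space with origin $O$ and unit ball $B_E$. $\mathcal{K}_0$ is the set of convex bodies of $V$ that are centrally symmetric about $O$ (the unit balls of norms on $V$), with the Hausdorff metric $\delta^h$. $\mathcal{K}_0^1:=\{K\in\mathcal{K}_0 \mid \delta^h(K,B_E)=1\}$. For a convex body $K$, $d(K)$ is its Euclidean diameter, $w(K)$ its (minimal) width, and $\alpha_0(K):=\frac{d(K)}{w(K)+d(K)}$ is its thinness, with range the interval $[\frac12,1)$. $\Phi_4$ is the map $(K,\alpha)\mapsto\alpha K$, by which $\mathcal{K}_0$ is identified with $\mathcal{K}_0^1\times[0,\infty)$; for $K'=\alpha K$ with $K\in\mathcal{K}_0^1$ write $\Phi_4^{-1}(K')=(K,\alpha)$ and $(\Phi_4^{-1}(K'))_2=\alpha$. $\sigma>0$ is a real parameter. For a measurable map $f$ and a measure $\mu$, $f_*\mu$ denotes the pushforward, $f_*\mu(B)=\mu(f^{-1}(B))$.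
   Formalization: The factor 4 in the definition of P is dropped, so P(A) = p(A)/(Φ(1/σ) − Φ(0)): the uniform law on [1/2,1) has density 2, so p has total mass Φ(1/σ) − Φ(0) and the printed P would have mass 4. *)

theory Defs
  imports "HOL-Probability.Probability"
begin

text \<open>The default value 0 makes the function total and non-negative, as the locale
  \<^locale>\<open>Metric_space\<close> requires; it plays no role for convex bodies.\<close>

definition hausdorff_dist :: "'a::metric_space set \<Rightarrow> 'a set \<Rightarrow> real" where
  "hausdorff_dist A B =
     (if bounded A \<and> A \<noteq> {} \<and> bounded B \<and> B \<noteq> {}
      then max (SUP a\<in>A. infdist a B) (SUP b\<in>B. infdist b A) else 0)"

text \<open>The unit balls of norms; in particular, they have non-empty interior.\<close>

definition sym_bodies :: "'a::euclidean_space set set" where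
  "sym_bodies = {K. compact K \<and> convex K \<and> interior K \<noteq> {} \<and> uminus ` K = K}"

definition sym_bodies1 :: "'a::euclidean_space set set" where
  "sym_bodies1 = {K \<in> sym_bodies. hausdorff_dist K (cball 0 1) = 1}"

lemma sym_bodies1_subset: "sym_bodies1 \<subseteq> sym_bodies"
  by (auto simp: sym_bodies1_def)

lemma hausdorff_dist_commute: "hausdorff_dist A B = hausdorff_dist B A"
  by (auto simp: hausdorff_dist_def max.commute)

lemma bdd_above_infdist:
  fixes A B :: "'a::metric_space set"
  assumes "bounded A" "B \<noteq> {}"
  shows "bdd_above ((\<lambda>a. infdist a B) ` A)"
proof -
  obtain b where b: "b \<in> B" using assms by blast
  obtain e where e: "\<And>a. a \<in> A \<Longrightarrow> dist b a \<le> e"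
    using assms(1) bounded_any_center[of A b] by blast
  have "infdist a B \<le> e" if "a \<in> A" for a
    using infdist_le[OF b, of a] e[OF that] by (simp add: dist_commute)
  then show ?thesis by (meson bdd_aboveI2)
qed

lemma infdist_le_hausdorff_dist:
  fixes A B :: "'a::metric_space set"
  assumes "bounded A" "bounded B" "B \<noteq> {}" "a \<in> A"
  shows "infdist a B \<le> hausdorff_dist A B"
proof -
  have "infdist a B \<le> (SUP a\<in>A. infdist a B)"
    by (rule cSUP_upper[OF assms(4) bdd_above_infdist[OF assms(1,3)]])
  moreover have "A \<noteq> {}" using assms(4) by blast
  ultimately show ?thesis using assms by (simp add: hausdorff_dist_def le_max_iff_disj)
qed

lemma hausdorff_dist_nonneg: "0 \<le> hausdorff_dist A B"
proof (cases "bounded A \<and> A \<noteq> {} \<and> bounded B \<and> B \<noteq> {}")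
  case True
  then obtain a where "a \<in> A" by blast
  then show ?thesis
    using True infdist_le_hausdorff_dist[of A B a] infdist_nonneg[of a B] by linarith
qed (simp only: hausdorff_dist_def if_False)

lemma infdist_triangle_hausdorff_dist:
  fixes A B C :: "'a::heine_borel set"
  assumes "compact A" "compact B" "B \<noteq> {}" "compact C" "C \<noteq> {}" "a \<in> A"
  shows "infdist a C \<le> hausdorff_dist A B + hausdorff_dist B C"
proof -
  obtain b where b: "b \<in> B" "infdist a B = dist a b"
    using infdist_attains_inf[OF compact_imp_closed[OF assms(2)] assms(3), of a] by blast
  have "infdist a C \<le> infdist b C + dist a b" by (rule infdist_triangle)
  also have "\<dots> \<le> hausdorff_dist B C + hausdorff_dist A B"
    using infdist_le_hausdorff_dist[of B C b] infdist_le_hausdorff_dist[of A B a] b assms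
    by (simp add: compact_imp_bounded add_mono)
  finally show ?thesis by simp
qed

lemma hausdorff_dist_triangle:
  fixes A B C :: "'a::heine_borel set"
  assumes "compact A" "A \<noteq> {}" "compact B" "B \<noteq> {}" "compact C" "C \<noteq> {}"
  shows "hausdorff_dist A C \<le> hausdorff_dist A B + hausdorff_dist B C"
proof -
  have "infdist c A \<le> hausdorff_dist A B + hausdorff_dist B C" if "c \<in> C" for c
    using infdist_triangle_hausdorff_dist[of C B A c] assms that
    by (simp add: hausdorff_dist_commute add.commute)
  then have "max (SUP a\<in>A. infdist a C) (SUP c\<in>C. infdist c A)
      \<le> hausdorff_dist A B + hausdorff_dist B C"
    using infdist_triangle_hausdorff_dist[of A B C] assms by (auto intro!: cSUP_least)
  then show ?thesis using assms by (simp add: hausdorff_dist_def[of A C] compact_imp_bounded)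
qed

lemma hausdorff_dist_eq_0_subset:
  fixes A B :: "'a::metric_space set"
  assumes "compact A" "compact B" "B \<noteq> {}" "hausdorff_dist A B = 0"
  shows "A \<subseteq> B"
proof
  fix a assume "a \<in> A"
  then have "infdist a B = 0"
    using infdist_le_hausdorff_dist[of A B a] infdist_nonneg[of a B] assms
    by (simp add: compact_imp_bounded)
  then show "a \<in> B"
    using in_closed_iff_infdist_zero[OF compact_imp_closed[OF assms(2)] assms(3)] by blast
qed

lemma hausdorff_dist_self:
  assumes "A \<noteq> {}"
  shows "hausdorff_dist A A = 0"
proof -
  have "(SUP a\<in>A. infdist a A) = 0" using assms by simp
  then show ?thesis by (simp add: hausdorff_dist_def)
qed

lemma Metric_space_sym_bodies:
  "Metric_space (sym_bodies :: 'a::euclidean_space set set) hausdorff_dist"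
proof
  fix A B C :: "'a set"
  have *: "compact K \<and> K \<noteq> {}" if "K \<in> sym_bodies" for K :: "'a set"
    using that by (auto simp: sym_bodies_def)
  show "0 \<le> hausdorff_dist A B" by (rule hausdorff_dist_nonneg)
  show "hausdorff_dist A B = hausdorff_dist B A" by (rule hausdorff_dist_commute)
  assume A: "A \<in> sym_bodies" and B: "B \<in> sym_bodies"
  show "hausdorff_dist A B = 0 \<longleftrightarrow> A = B"
    using hausdorff_dist_eq_0_subset[of A B] hausdorff_dist_eq_0_subset[of B A]
      hausdorff_dist_self[of A] *[OF A] *[OF B] by (auto simp: hausdorff_dist_commute)
  assume C: "C \<in> sym_bodies"
  show "hausdorff_dist A C \<le> hausdorff_dist A B + hausdorff_dist B C"
    using hausdorff_dist_triangle[of A B C] *[OF A] *[OF B] *[OF C] by blast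
qed

lemma Metric_space_sym_bodies1:
  "Metric_space (sym_bodies1 :: 'a::euclidean_space set set) hausdorff_dist"
  using Metric_space.subspace[OF Metric_space_sym_bodies sym_bodies1_subset] .

text \<open>The Borel sigma-algebra of a set of convex bodies with respect to the Hausdorff metric.\<close>

definition hausdorff_borel :: "'a::metric_space set set \<Rightarrow> 'a set measure" where
  "hausdorff_borel \<C> = sigma \<C> {U. openin (Metric_space.mtopology \<C> hausdorff_dist) U}"

definition width :: "'a::euclidean_space set \<Rightarrow> real" where
  "width K = (INF u\<in>sphere 0 1. (SUP x\<in>K. u \<bullet> x) - (INF x\<in>K. u \<bullet> x))"

definition thinness :: "'a::euclidean_space set \<Rightarrow> real" where
  "thinness K = diameter K / (width K + diameter K)"

definition scale_body :: "'a::euclidean_space set \<times> real \<Rightarrow> 'a set" where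
  "scale_body = (\<lambda>(K, \<alpha>). (*\<^sub>R) \<alpha> ` K)"

text \<open>The second component of the inverse of \<^const>\<open>scale_body\<close>. Since \<open>scale_body (K, 0) = {0}\<close>
  is not in \<^const>\<open>sym_bodies\<close>, the scale of an element of \<^const>\<open>sym_bodies\<close> is positive.\<close>

definition body_scale :: "'a::euclidean_space set \<Rightarrow> real" where
  "body_scale K = snd (inv_into (sym_bodies1 \<times> {0..}) scale_body K)"

definition thin_p :: "real \<Rightarrow> 'a::euclidean_space set measure \<Rightarrow> 'a set set \<Rightarrow> real" where
  "thin_p \<sigma> \<nu>\<^sub>0 \<A> = 1 / sqrt (2 * pi * \<sigma>\<^sup>2) *
     (LINT K:\<A>|\<nu>\<^sub>0. exp (- (hausdorff_dist (cball 0 1)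
        (scale_body (K, thinness K / body_scale K)))\<^sup>2 / (2 * \<sigma>\<^sup>2)))"

abbreviation std_normal_cdf :: "real \<Rightarrow> real" where
  "std_normal_cdf \<equiv> cdf std_normal_distribution"

text \<open>A uniform distribution on \<open>[1/2, 1)\<close> has density 2. Substituting \<open>u = 2 t - 1\<close> therefore
  gives \<open>thin_p \<sigma> \<nu>\<^sub>0 sym_bodies = std_normal_cdf (1 / \<sigma>) - std_normal_cdf 0\<close>, and this is the
  normalising constant; with a further factor of 4 in the numerator (which would correct for
  a density of 1/2) the total mass would be 4.\<close>

definition thin_P :: "real \<Rightarrow> 'a::euclidean_space set measure \<Rightarrow> 'a set set \<Rightarrow> real" where
  "thin_P \<sigma> \<nu>\<^sub>0 \<A> = thin_p \<sigma> \<nu>\<^sub>0 \<A> / (std_normal_cdf (1 / \<sigma>) - std_normal_cdf 0)"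

text \<open>The set function \<^const>\<open>thin_P\<close> as a measure. By definition of \<^const>\<open>measure_of\<close>, this is
  the zero measure unless \<^const>\<open>thin_P\<close> is countably additive.\<close>

definition thin_measure :: "real \<Rightarrow> 'a::euclidean_space set measure \<Rightarrow> 'a set measure" where
  "thin_measure \<sigma> \<nu>\<^sub>0 =
     measure_of (space \<nu>\<^sub>0) (sets \<nu>\<^sub>0) (\<lambda>\<A>. ennreal (thin_P \<sigma> \<nu>\<^sub>0 \<A>))"

text \<open>The normal distribution with mean \<open>\<mu>\<close> and standard deviation \<open>s\<close> (before truncation),
  conditioned on \<open>A\<close>.\<close>

definition truncated_normal :: "real \<Rightarrow> real \<Rightarrow> real set \<Rightarrow> real measure" where
  "truncated_normal \<mu> s A = uniform_measure (density lborel (normal_density \<mu> s)) A"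

end

theory Submission
  imports Defs
begin

text \<open>For a symmetric body \<open>K\<close> with diameter \<open>d\<close> and width \<open>w\<close>, the Hausdorff distance to the
  unit ball is \<open>max (d/2 - 1) (1 - w/2)\<close>. Hence the normalized bodies are those with \<open>d = 4\<close>, and
  after scaling to diameter \<open>4 t\<close>, where \<open>t = d / (w + d)\<close>, the distance is \<open>2 t - 1\<close>. So the
  density depends on the body only through its thinness \<open>t\<close>, which is scale invariant and therefore
  uniform under \<open>\<nu>\<^sub>0\<close>, and pushing forward along the thinness gives the uniform distribution
  reweighted by \<open>exp (- (2 t - 1)\<^sup>2 / (2 \<sigma>\<^sup>2))\<close>.\<close>

section \<open>Width and diameter of symmetric bodies\<close>

text \<open>The support function of convex geometry. For a body symmetric about the origin the
  breadth in a unit direction \<open>u\<close> is \<open>2 * support K u\<close>, so statements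
  about \<open>width\<close> reduce to it.\<close>

definition support :: "'a::euclidean_space set \<Rightarrow> 'a \<Rightarrow> real" where
  "support K u = (SUP x\<in>K. u \<bullet> x)"

lemma inner_le_norm_if_unit: "norm u = 1 \<Longrightarrow> u \<bullet> x \<le> norm x"
  using norm_cauchy_schwarz[of u x] by simp

lemma support_upper:
  assumes "compact K" "x \<in> K"
  shows "u \<bullet> x \<le> support K u"
proof -
  have "compact ((\<lambda>x. u \<bullet> x) ` K)"
    by (intro compact_continuous_image continuous_intros assms)
  then have "bdd_above ((\<lambda>x. u \<bullet> x) ` K)"
    by (intro bounded_imp_bdd_above compact_imp_bounded)
  then show ?thesis unfolding support_def using assms(2) by (rule cSUP_upper2) simp
qed

lemma support_least: "K \<noteq> {} \<Longrightarrow> (\<And>x. x \<in> K \<Longrightarrow> u \<bullet> x \<le> c) \<Longrightarrow> support K u \<le> c"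
  unfolding support_def by (rule cSUP_least)

lemma sym_bodiesD:
  assumes "K \<in> sym_bodies"
  shows "compact K" "convex K" "bounded K" "K \<noteq> {}" "0 \<in> interior K" "0 \<in> K"
    "x \<in> K \<Longrightarrow> - x \<in> K"
proof -
  show K: "compact K" "convex K" "bounded K" "K \<noteq> {}"
    using assms by (auto simp: sym_bodies_def compact_imp_bounded)
  show "- x \<in> K" if "x \<in> K" for x
    using assms that by (auto simp: sym_bodies_def)
  obtain x where x: "x \<in> interior K" using assms by (auto simp: sym_bodies_def)
  have "uminus ` interior K = interior K"
    using assms interior_negations[of K] by (simp add: sym_bodies_def)
  then have "- x \<in> interior K" using x by blast
  \<comment> \<open>The origin is the midpoint of an interior point and its mirror image, and the
    interior is convex.\<close>
  then have "(1/2) *\<^sub>R x + (1/2) *\<^sub>R (- x) \<in> interior K"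
    using x by (intro convexD convex_interior K) auto
  then show "0 \<in> interior K" by simp
  then show "0 \<in> K" using interior_subset by blast
qed

lemma support_nonneg: "K \<in> sym_bodies \<Longrightarrow> 0 \<le> support K u"
  using support_upper[of K 0 u] sym_bodiesD(1,6)[of K] by simp

lemma INF_inner_eq_support:
  assumes "K \<in> sym_bodies"
  shows "(INF x\<in>K. u \<bullet> x) = - support K u"
proof -
  \<comment> \<open>A real infimum is the negative of the supremum of the negated set, and symmetry
    makes the set of inner products its own negation.\<close>
  have "uminus ` (\<lambda>x. u \<bullet> x) ` K = (\<lambda>x. u \<bullet> x) ` K"
    using sym_bodiesD(7)[OF assms] by (force simp: image_iff)
  then show ?thesis by (simp add: Inf_real_def support_def)
qed

text \<open>The basis of a type of class \<open>euclidean_space\<close> is nonempty, which rules out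
  dimension zero. Hence infima over the unit sphere are taken over a nonempty set.\<close>

lemma unit_vector_ex: "\<exists>u::'a::euclidean_space. u \<in> sphere 0 1"
  using nonempty_Basis by (metis ex_in_conv mem_sphere_0 norm_Basis)

lemma width_eq_INF_support:
  assumes "K \<in> sym_bodies"
  shows "width K = (INF u\<in>sphere 0 1. 2 * support K u)"
  using INF_inner_eq_support[OF assms] by (simp add: width_def support_def)

lemma width_le:
  assumes "K \<in> sym_bodies" "norm u = 1"
  shows "width K \<le> 2 * support K u"
  unfolding width_eq_INF_support[OF assms(1)]
  by (rule cINF_lower) (auto intro!: bdd_belowI2[of _ 0] simp: support_nonneg assms)

lemma width_greatest:
  assumes "K \<in> sym_bodies" "\<And>u. norm u = 1 \<Longrightarrow> c \<le> 2 * support K u"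
  shows "c \<le> width K"
  unfolding width_eq_INF_support[OF assms(1)]
  using unit_vector_ex assms(2) by (intro cINF_greatest) auto

text \<open>Both \<open>x\<close> and \<open>- x\<close> lie in \<open>K\<close>, at distance
  \<open>2 * norm x\<close>. Together with \<open>diameter_le_twice_norm\<close> this makes the
  diameter twice the largest norm in \<open>K\<close>.\<close>

lemma norm_le_half_diameter:
  assumes "K \<in> sym_bodies" "x \<in> K"
  shows "2 * norm x \<le> diameter K"
proof -
  have "dist x (- x) = 2 * norm x" by (simp add: dist_norm flip: scaleR_2)
  then show ?thesis
    using diameter_bounded_bound[of K x "- x"] sym_bodiesD[OF assms(1)] assms(2) by simp
qed

lemma diameter_le_twice_norm:
  assumes "K \<noteq> {}" "\<And>x. x \<in> K \<Longrightarrow> 2 * norm x \<le> c"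
  shows "diameter K \<le> c"
proof (rule diameter_le)
  fix x y assume "x \<in> K" "y \<in> K"
  then show "norm (x - y) \<le> c"
    using norm_triangle_ineq4[of x y] assms(2)[of x] assms(2)[of y] by linarith
qed (use assms in simp)

text \<open>A ball about the origin lies in \<open>K\<close>, so every support value is at least its
  radius. This bound is uniform in the direction and survives the infimum.\<close>

lemma width_pos:
  assumes "K \<in> sym_bodies"
  shows "0 < width K"
proof -
  obtain e where e: "e > 0" "cball 0 e \<subseteq> K"
    using sym_bodiesD(5)[OF assms] by (auto simp: mem_interior_cball)
  have "2 * e \<le> width K"
  proof (rule width_greatest[OF assms])
    fix u :: 'a assume u: "norm u = 1"
    then have "e *\<^sub>R u \<in> K" using e by auto
    from support_upper[OF sym_bodiesD(1)[OF assms] this, of u]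
    show "2 * e \<le> 2 * support K u" using u by (simp add: dot_square_norm)
  qed
  then show ?thesis using e by simp
qed

lemma width_le_diameter:
  assumes "K \<in> sym_bodies"
  shows "width K \<le> diameter K"
proof -
  obtain u :: 'a where u: "norm u = 1" using unit_vector_ex by auto
  have "support K u \<le> diameter K / 2"
  proof (rule support_least)
    fix x assume "x \<in> K"
    then show "u \<bullet> x \<le> diameter K / 2"
      using inner_le_norm_if_unit[OF u, of x] norm_le_half_diameter[OF assms] by force
  qed (rule sym_bodiesD[OF assms])
  then show ?thesis using width_le[OF assms u] by simp
qed

lemma diameter_pos: "K \<in> sym_bodies \<Longrightarrow> 0 < diameter K"
  using width_pos width_le_diameter by fastforce

lemma thinness_bounds:
  assumes "K \<in> sym_bodies"
  shows "1/2 \<le> thinness K" "thinness K < 1"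
  using width_pos[OF assms] width_le_diameter[OF assms]
  by (auto simp: thinness_def field_simps)

section \<open>Homotheties\<close>

lemma scaleR_image_inverse:
  fixes K :: "'a::real_vector set"
  assumes "c > 0"
  shows "(*\<^sub>R) (1 / c) ` (*\<^sub>R) c ` K = K"
  using assms by (simp add: image_image)

lemma scale_sym_bodies:
  assumes "K \<in> sym_bodies" "c > 0"
  shows "(*\<^sub>R) c ` K \<in> sym_bodies"
proof -
  have "interior ((*\<^sub>R) c ` K) = (*\<^sub>R) c ` interior K"
    using assms by (intro interior_injective_linear_image linear_scaleR injI) simp
  moreover have "uminus ` (*\<^sub>R) c ` K = (*\<^sub>R) c ` uminus ` K"
    by (simp add: image_image)
  ultimately show ?thesis
    using assms by (auto simp: sym_bodies_def compact_scaling convex_scaling)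
qed

lemma support_scale_le:
  assumes "K \<in> sym_bodies" "c > 0"
  shows "support ((*\<^sub>R) c ` K) u \<le> c * support K u"
  using assms support_upper[OF sym_bodiesD(1)[OF assms(1)], of _ u] sym_bodiesD(4)[OF assms(1)]
  by (intro support_least) auto

lemma width_scale_le:
  assumes "K \<in> sym_bodies" "c > 0"
  shows "width ((*\<^sub>R) c ` K) \<le> c * width K"
proof -
  have "width ((*\<^sub>R) c ` K) / c \<le> width K"
  proof (rule width_greatest[OF assms(1)])
    fix u :: 'a assume "norm u = 1"
    then show "width ((*\<^sub>R) c ` K) / c \<le> 2 * support K u"
      using width_le[OF scale_sym_bodies[OF assms], of u] support_scale_le[OF assms, of u] assms(2)
      by (simp add: field_simps)
  qed
  then show ?thesis using assms(2) by (simp add: field_simps)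
qed

lemma diameter_scale_le:
  assumes "K \<in> sym_bodies" "c > 0"
  shows "diameter ((*\<^sub>R) c ` K) \<le> c * diameter K"
  using assms norm_le_half_diameter[OF assms(1)] sym_bodiesD(4)[OF assms(1)]
  by (intro diameter_le_twice_norm) (auto simp: algebra_simps)

text \<open>The reverse inequality is \<open>width_scale_le\<close> for the scaled body and the
  factor \<open>1 / c\<close>, which leads back to \<open>K\<close>. The diameter is treated
  alike.\<close>

lemma width_scale:
  assumes "K \<in> sym_bodies" "c > 0"
  shows "width ((*\<^sub>R) c ` K) = c * width K"
  using width_scale_le[OF assms] width_scale_le[OF scale_sym_bodies[OF assms], of "1 / c"] assms(2)
  unfolding scaleR_image_inverse[OF assms(2)] by (simp add: field_simps)

lemma diameter_scale:
  assumes "K \<in> sym_bodies" "c > 0"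
  shows "diameter ((*\<^sub>R) c ` K) = c * diameter K"
  using diameter_scale_le[OF assms] diameter_scale_le[OF scale_sym_bodies[OF assms], of "1 / c"] assms(2)
  unfolding scaleR_image_inverse[OF assms(2)] by (simp add: field_simps)

lemma thinness_scale:
  assumes "K \<in> sym_bodies" "c > 0"
  shows "thinness ((*\<^sub>R) c ` K) = thinness K"
  using assms by (simp add: thinness_def width_scale diameter_scale flip: distrib_left)

section \<open>Hausdorff distance to the unit ball\<close>

lemma hausdorff_dist_le:
  assumes "bounded A" "A \<noteq> {}" "bounded B" "B \<noteq> {}"
    and "\<And>a. a \<in> A \<Longrightarrow> infdist a B \<le> r" "\<And>b. b \<in> B \<Longrightarrow> infdist b A \<le> r"
  shows "hausdorff_dist A B \<le> r"
  using assms by (auto simp: hausdorff_dist_def intro!: cSUP_least)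

lemma infdist_cball_le:
  fixes x :: "'a::euclidean_space"
  shows "infdist x (cball 0 1) \<le> max 0 (norm x - 1)"
proof (cases "norm x \<le> 1")
  case False
  then have "x \<noteq> 0" by auto
  \<comment> \<open>The radial projection onto the unit sphere serves as the near point.\<close>
  have "infdist x (cball 0 1) \<le> dist x (x /\<^sub>R norm x)"
    using \<open>x \<noteq> 0\<close> by (intro infdist_le) auto
  also have "x - x /\<^sub>R norm x = ((norm x - 1) / norm x) *\<^sub>R x"
    using \<open>x \<noteq> 0\<close> by (simp add: divide_inverse left_diff_distrib scaleR_diff_left)
  then have "dist x (x /\<^sub>R norm x) = norm (((norm x - 1) / norm x) *\<^sub>R x)"
    unfolding dist_norm by (rule arg_cong)
  also have "\<dots> = norm x - 1" using False \<open>x \<noteq> 0\<close> by simp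
  finally show ?thesis by simp
qed simp

text \<open>For \<open>b\<close> outside \<open>K\<close>, let \<open>p\<close> be the closest point
  of \<open>K\<close> and \<open>u\<close> the unit vector from \<open>p\<close> towards
  \<open>b\<close>. The hyperplane through \<open>p\<close> with normal \<open>u\<close> supports
  \<open>K\<close>, so \<open>norm (b - p) = u \<bullet> b - u \<bullet> p\<close> is at most
  \<open>1 - support K u\<close>, and \<open>support K u\<close> is at least half the width.\<close>

lemma infdist_le_width_defect:
  assumes K: "K \<in> sym_bodies" and b: "norm b \<le> 1"
  shows "infdist b K \<le> max 0 (1 - width K / 2)"
proof (cases "b \<in> K")
  case False
  note K' = sym_bodiesD[OF K]
  define p where "p = closest_point K b"
  have p: "p \<in> K" unfolding p_def
    by (rule closest_point_in_set) (use K' in \<open>auto simp: compact_imp_closed\<close>)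
  then have bp: "b \<noteq> p" using False by blast
  define u where "u = (b - p) /\<^sub>R norm (b - p)"
  have u: "norm u = 1" using bp by (simp add: u_def)
  have "support K u \<le> u \<bullet> p"
  proof (rule support_least[OF K'(4)])
    fix x assume "x \<in> K"
    then have "(b - p) \<bullet> (x - p) \<le> 0"
      unfolding p_def by (intro closest_point_dot compact_imp_closed K')
    then have "u \<bullet> (x - p) \<le> 0"
      by (simp add: u_def mult_nonneg_nonpos)
    then show "u \<bullet> x \<le> u \<bullet> p" by (simp add: inner_diff_right)
  qed
  moreover have "u \<bullet> (b - p) = norm (b - p)"
    using bp by (simp add: u_def dot_square_norm power2_eq_square)
  moreover have "u \<bullet> b \<le> 1"
    using inner_le_norm_if_unit[OF u, of b] b by linarith
  moreover have "infdist b K \<le> norm (b - p)"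
    using infdist_le[OF p, of b] by (simp add: dist_norm)
  ultimately show ?thesis
    using width_le[OF K u] by (simp add: inner_diff_right)
qed simp

lemma hausdorff_dist_cball:
  assumes K: "K \<in> sym_bodies"
  shows "hausdorff_dist (cball 0 1) K = max (diameter K / 2 - 1) (1 - width K / 2)"
proof (rule antisym)
  note K' = sym_bodiesD[OF K]
  \<comment> \<open>Points that already lie in the other set contribute distance 0. The maximum
    absorbs this, being nonnegative because of \<open>width K \<le> diameter K\<close>.\<close>
  have nonneg: "0 \<le> max (diameter K / 2 - 1) (1 - width K / 2)"
    using width_le_diameter[OF K] by linarith
  show "hausdorff_dist (cball 0 1) K \<le> max (diameter K / 2 - 1) (1 - width K / 2)"
  proof (rule hausdorff_dist_le)
    fix a :: 'a assume "a \<in> cball 0 1"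
    then show "infdist a K \<le> max (diameter K / 2 - 1) (1 - width K / 2)"
      using infdist_le_width_defect[OF K, of a] nonneg by auto
  next
    fix b assume "b \<in> K"
    then show "infdist b (cball 0 1) \<le> max (diameter K / 2 - 1) (1 - width K / 2)"
      using infdist_cball_le[of b] norm_le_half_diameter[OF K, of b] nonneg by auto
  qed (use K' in auto)
  \<comment> \<open>Conversely, a point of \<open>K\<close> of large norm is far from the ball, and
    a unit vector \<open>u\<close> is far from \<open>K\<close> when \<open>support K u\<close> is
    small. So the distance bounds both terms.\<close>
  let ?D = "hausdorff_dist (cball 0 1) K"
  have "diameter K \<le> 2 * (?D + 1)"
  proof (rule diameter_le_twice_norm[OF K'(4)])
    fix x assume x: "x \<in> K"
    obtain b where b: "b \<in> cball 0 1" "infdist x (cball 0 1) = dist x b"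
      using infdist_attains_inf[of "cball 0 1" x] by auto
    have "norm x \<le> norm b + dist x b"
      using norm_triangle_ineq[of b "x - b"] by (simp add: dist_norm)
    then show "2 * norm x \<le> 2 * (?D + 1)"
      using infdist_le_hausdorff_dist[of K "cball 0 1" x] b x K'
      by (simp add: hausdorff_dist_commute)
  qed
  moreover have "2 * (1 - ?D) \<le> width K"
  proof (rule width_greatest[OF K])
    fix u :: 'a assume u: "norm u = 1"
    obtain x where x: "x \<in> K" "infdist u K = dist u x"
      using infdist_attains_inf[OF compact_imp_closed[OF K'(1)] K'(4), of u] by blast
    have "dist u x \<le> ?D"
      using infdist_le_hausdorff_dist[of "cball 0 1" K u] u x K' by auto
    moreover have "u \<bullet> (u - x) \<le> dist u x"
      using inner_le_norm_if_unit[OF u, of "u - x"] by (simp add: dist_norm)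
    ultimately show "2 * (1 - ?D) \<le> 2 * support K u"
      using support_upper[OF K'(1) x(1), of u] u by (simp add: inner_diff_right dot_square_norm)
  qed
  ultimately show "max (diameter K / 2 - 1) (1 - width K / 2) \<le> ?D" by simp
qed

text \<open>The term \<open>1 - width K / 2\<close> is less than 1, so the distance is 1
  only if the diameter is 4.\<close>

lemma sym_bodies1_iff: "K \<in> sym_bodies1 \<longleftrightarrow> K \<in> sym_bodies \<and> diameter K = 4"
proof -
  have "max (diameter K / 2 - 1) (1 - width K / 2) = 1 \<longleftrightarrow> diameter K = 4" if "K \<in> sym_bodies"
    using width_pos[OF that] by (auto simp: max_def)
  then show ?thesis
    by (auto simp: sym_bodies1_def hausdorff_dist_commute[of K] hausdorff_dist_cball)
qed

text \<open>\<open>inv_into\<close> returns some preimage, so an explicit one is exhibited first to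
  show that \<open>K\<close> is in the image. Whatever preimage \<open>(L, \<alpha>)\<close> is
  chosen, \<open>diameter L = 4\<close> determines \<open>\<alpha>\<close>.\<close>

lemma body_scale_eq:
  assumes K: "K \<in> sym_bodies"
  shows "body_scale K = diameter K / 4"
proof -
  let ?c = "diameter K / 4"
  have c: "?c > 0" using diameter_pos[OF K] by simp
  have "(*\<^sub>R) (1 / ?c) ` K \<in> sym_bodies1"
    unfolding sym_bodies1_iff
    using c K scale_sym_bodies[OF K, of "1 / ?c"] diameter_scale[OF K, of "1 / ?c"] by simp
  moreover have "scale_body ((*\<^sub>R) (1 / ?c) ` K, ?c) = K"
    using diameter_pos[OF K] by (simp add: scale_body_def image_image)
  ultimately have "K \<in> scale_body ` (sym_bodies1 \<times> {0..})"
    using c by (intro image_eqI[of _ _ "((*\<^sub>R) (1 / ?c) ` K, ?c)"]) auto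
  note inv = inv_into_into[OF this] f_inv_into_f[OF this]
  obtain L \<alpha> where L: "inv_into (sym_bodies1 \<times> {0..}) scale_body K = (L, \<alpha>)" by fastforce
  then have *: "L \<in> sym_bodies1" "\<alpha> \<ge> 0" "(*\<^sub>R) \<alpha> ` L = K"
    using inv by (auto simp: scale_body_def)
  \<comment> \<open>The domain of scales contains 0, but this scale would collapse the body to the
    origin.\<close>
  have "\<alpha> \<noteq> 0"
  proof
    assume "\<alpha> = 0"
    then have "K \<subseteq> {0}" using * by auto
    then have "diameter K \<le> 0"
      by (intro diameter_le_twice_norm sym_bodiesD[OF K]) auto
    then show False using diameter_pos[OF K] by simp
  qed
  then show ?thesis
    using * diameter_scale[of L \<alpha>] by (simp add: body_scale_def L sym_bodies1_iff)
qed

text \<open>The scaled body has diameter \<open>4 t\<close> and width \<open>4 (1 - t)\<close>, so the two terms of the maximum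
  in \<open>hausdorff_dist_cball\<close> coincide.\<close>

lemma hausdorff_dist_cball_normalized:
  assumes K: "K \<in> sym_bodies"
  shows "hausdorff_dist (cball 0 1) (scale_body (K, thinness K / body_scale K)) = 2 * thinness K - 1"
proof -
  let ?c = "thinness K / body_scale K"
  have pos: "width K > 0" "diameter K > 0" using width_pos diameter_pos K by auto
  have c: "?c = 4 / (width K + diameter K)"
    using pos by (simp add: body_scale_eq[OF K] thinness_def)
  have "?c > 0" unfolding c using pos by simp
  from hausdorff_dist_cball[OF scale_sym_bodies[OF K this]]
  have "hausdorff_dist (cball 0 1) (scale_body (K, ?c)) =
      max (?c * diameter K / 2 - 1) (1 - ?c * width K / 2)"
    by (simp add: scale_body_def width_scale[OF K \<open>?c > 0\<close>] diameter_scale[OF K \<open>?c > 0\<close>])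
  also have "?c * diameter K / 2 - 1 = 2 * thinness K - 1"
    unfolding c using pos by (simp add: thinness_def field_simps)
  also have "1 - ?c * width K / 2 = 2 * thinness K - 1"
    unfolding c using pos by (simp add: thinness_def divide_simps) (simp add: algebra_simps)
  finally show ?thesis by simp
qed

section \<open>Measurability\<close>

lemma space_hausdorff_borel [simp]: "space (hausdorff_borel \<C>) = \<C>"
  by (simp add: hausdorff_borel_def space_measure_of_conv)

lemma sets_hausdorff_borel:
  assumes "Metric_space \<C> hausdorff_dist"
  shows "sets (hausdorff_borel \<C>) =
    sigma_sets \<C> {U. openin (Metric_space.mtopology \<C> hausdorff_dist) U}"
proof -
  interpret Metric_space \<C> hausdorff_dist by fact
  have "{U. openin mtopology U} \<subseteq> Pow \<C>"
    using openin_subset[of mtopology] by auto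
  then show ?thesis unfolding hausdorff_borel_def by (rule sets_measure_of)
qed

lemma openin_in_sets_hausdorff_borel:
  assumes "Metric_space \<C> hausdorff_dist"
    and "openin (Metric_space.mtopology \<C> hausdorff_dist) U"
  shows "U \<in> sets (hausdorff_borel \<C>)"
  using assms by (auto simp: sets_hausdorff_borel)

text \<open>A Lipschitz function is continuous for the Hausdorff metric, so preimages of open sets
  are open and hence measurable. Swapping \<open>K\<close> and \<open>L\<close> turns the one-sided
  hypothesis into a bound on the absolute difference.\<close>

lemma borel_measurable_hausdorff_lipschitz:
  assumes M: "Metric_space \<C> hausdorff_dist"
    and L: "\<And>K L. K \<in> \<C> \<Longrightarrow> L \<in> \<C> \<Longrightarrow> f K - f L \<le> c * hausdorff_dist K L"
  shows "(f :: _ \<Rightarrow> real) \<in> borel_measurable (hausdorff_borel \<C>)"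
proof (rule borel_measurableI)
  interpret Metric_space \<C> hausdorff_dist by fact
  fix S :: "real set" assume S: "open S"
  have "openin mtopology (f -` S \<inter> \<C>)"
    unfolding openin_mtopology
  proof safe
    fix K assume K: "K \<in> \<C>" "f K \<in> S"
    then obtain e where e: "e > 0" "ball (f K) e \<subseteq> S"
      using S by (auto simp: open_contains_ball)
    \<comment> \<open>The denominator \<open>\<bar>c\<bar> + 1\<close> is positive for every
      \<open>c\<close>.\<close>
    define r where "r = e / (\<bar>c\<bar> + 1)"
    have "L \<in> \<C> \<and> f L \<in> S" if L': "L \<in> mball K r" for L
    proof -
      have KL: "L \<in> \<C>" "hausdorff_dist K L < r" using L' by auto
      have "c * hausdorff_dist K L \<le> (\<bar>c\<bar> + 1) * hausdorff_dist K L"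
        by (intro mult_right_mono) auto
      also have "\<dots> < (\<bar>c\<bar> + 1) * r" using KL by (intro mult_strict_left_mono) auto
      also have "\<dots> = e" by (simp add: r_def)
      finally have "\<bar>f K - f L\<bar> < e"
        using L[of K L] L[of L K] K KL by (simp add: commute)
      then show ?thesis using e KL by (auto simp: dist_real_def)
    qed
    then show "\<exists>r>0. mball K r \<subseteq> f -` S \<inter> \<C>"
      using e by (intro exI[of _ r]) (auto simp: r_def)
  qed
  then show "f -` S \<inter> space (hausdorff_borel \<C>) \<in> sets (hausdorff_borel \<C>)"
    by (simp add: openin_in_sets_hausdorff_borel M)
qed

section \<open>Lipschitz dependence of width and diameter on the body\<close>

lemma near_point_hausdorff:
  fixes K L :: "'a::heine_borel set"
  assumes "compact K" "compact L" "L \<noteq> {}" "x \<in> K"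
  obtains y where "y \<in> L" "dist x y \<le> hausdorff_dist K L"
proof -
  obtain y where "y \<in> L" "infdist x L = dist x y"
    using infdist_attains_inf[OF compact_imp_closed[OF assms(2)] assms(3), of x] by blast
  then show thesis
    using infdist_le_hausdorff_dist[of K L x] assms that by (simp add: compact_imp_bounded)
qed

lemma support_hausdorff_lipschitz:
  assumes K: "K \<in> sym_bodies" and L: "L \<in> sym_bodies" and u: "norm u = 1"
  shows "support K u \<le> support L u + hausdorff_dist K L"
proof (rule support_least)
  fix x assume "x \<in> K"
  then obtain y where y: "y \<in> L" "dist x y \<le> hausdorff_dist K L"
    using near_point_hausdorff sym_bodiesD[OF K] sym_bodiesD[OF L] by metis
  have "u \<bullet> x = u \<bullet> y + u \<bullet> (x - y)" by (simp add: inner_diff_right)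
  also have "\<dots> \<le> support L u + hausdorff_dist K L"
    using support_upper[OF sym_bodiesD(1)[OF L] y(1), of u] y(2)
      inner_le_norm_if_unit[OF u, of "x - y"] by (simp add: dist_norm)
  finally show "u \<bullet> x \<le> support L u + hausdorff_dist K L" .
qed (rule sym_bodiesD[OF K])

text \<open>The doubled support values in unit directions are all 2-Lipschitz in the body, and their
  infimum inherits the constant.\<close>

lemma width_hausdorff_lipschitz:
  assumes K: "K \<in> sym_bodies" and L: "L \<in> sym_bodies"
  shows "width K - width L \<le> 2 * hausdorff_dist K L"
proof -
  have "width K - 2 * hausdorff_dist K L \<le> width L"
  proof (rule width_greatest[OF L])
    fix u :: 'a assume u: "norm u = 1"
    show "width K - 2 * hausdorff_dist K L \<le> 2 * support L u"
      using width_le[OF K u] support_hausdorff_lipschitz[OF K L u] by simp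
  qed
  then show ?thesis by simp
qed

lemma diameter_hausdorff_lipschitz:
  assumes K: "K \<in> sym_bodies" and L: "L \<in> sym_bodies"
  shows "diameter K - diameter L \<le> 2 * hausdorff_dist K L"
proof -
  have "diameter K \<le> diameter L + 2 * hausdorff_dist K L"
  proof (rule diameter_le_twice_norm)
    fix x assume "x \<in> K"
    then obtain y where y: "y \<in> L" "dist x y \<le> hausdorff_dist K L"
      using near_point_hausdorff sym_bodiesD[OF K] sym_bodiesD[OF L] by metis
    have "norm x \<le> norm y + dist x y"
      using norm_triangle_ineq[of y "x - y"] by (simp add: dist_norm)
    then show "2 * norm x \<le> diameter L + 2 * hausdorff_dist K L"
      using y norm_le_half_diameter[OF L y(1)] by simp
  qed (rule sym_bodiesD[OF K])
  then show ?thesis by simp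
qed

text \<open>Thinness is a quotient built from Lipschitz functions. A general \<open>\<C>\<close>
  covers both the normalized bodies and all symmetric bodies.\<close>

lemma borel_measurable_thinness:
  assumes "\<C> \<subseteq> sym_bodies"
  shows "thinness \<in> borel_measurable (hausdorff_borel \<C>)"
proof -
  have M: "Metric_space \<C> hausdorff_dist"
    using Metric_space.subspace[OF Metric_space_sym_bodies assms] .
  have [measurable]: "width \<in> borel_measurable (hausdorff_borel \<C>)"
      "diameter \<in> borel_measurable (hausdorff_borel \<C>)"
    using assms by (auto intro!: borel_measurable_hausdorff_lipschitz[OF M, where c = 2]
        width_hausdorff_lipschitz diameter_hausdorff_lipschitz)
  have "(\<lambda>K. diameter K / (width K + diameter K)) \<in> borel_measurable (hausdorff_borel \<C>)"
    by measurable
  then show ?thesis by (simp add: thinness_def[abs_def])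
qed

section \<open>Joint measurability of scaling\<close>

lemma hausdorff_dist_scale_le:
  assumes K: "K \<in> sym_bodies" and L: "L \<in> sym_bodies1" and pos: "\<alpha> > 0" "\<beta> > 0"
  shows "hausdorff_dist ((*\<^sub>R) \<alpha> ` K) ((*\<^sub>R) \<beta> ` L) \<le> \<alpha> * hausdorff_dist K L + 2 * \<bar>\<alpha> - \<beta>\<bar>"
proof (rule hausdorff_dist_le)
  have L': "L \<in> sym_bodies" "diameter L = 4" using L by (auto simp: sym_bodies1_iff)
  note K = K sym_bodiesD[OF K] and L = sym_bodiesD[OF L'(1)]
  have *: "dist (\<alpha> *\<^sub>R x) (\<beta> *\<^sub>R y) \<le> \<alpha> * hausdorff_dist K L + 2 * \<bar>\<alpha> - \<beta>\<bar>"
    if "y \<in> L" "dist x y \<le> hausdorff_dist K L" for x y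
  proof -
    \<comment> \<open>The change of body at the fixed scale \<open>\<alpha>\<close> is separated
      from the change of scale at the point \<open>y\<close>, whose norm is at most 2 because
      \<open>L\<close> has diameter 4.\<close>
    have "\<alpha> *\<^sub>R x - \<beta> *\<^sub>R y = \<alpha> *\<^sub>R (x - y) + (\<alpha> - \<beta>) *\<^sub>R y"
      by (simp add: algebra_simps)
    then have "dist (\<alpha> *\<^sub>R x) (\<beta> *\<^sub>R y) \<le> \<alpha> * dist x y + \<bar>\<alpha> - \<beta>\<bar> * norm y"
      using norm_triangle_ineq[of "\<alpha> *\<^sub>R (x - y)" "(\<alpha> - \<beta>) *\<^sub>R y"] pos by (simp add: dist_norm)
    also have "\<dots> \<le> \<alpha> * hausdorff_dist K L + \<bar>\<alpha> - \<beta>\<bar> * 2"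
      using that pos norm_le_half_diameter[OF L'(1) that(1)] L'(2)
      by (intro add_mono mult_left_mono) auto
    finally show ?thesis by simp
  qed
  show "bounded ((*\<^sub>R) \<alpha> ` K)" "bounded ((*\<^sub>R) \<beta> ` L)"
    using K L by (auto intro: bounded_scaling)
  show "(*\<^sub>R) \<alpha> ` K \<noteq> {}" "(*\<^sub>R) \<beta> ` L \<noteq> {}" using K L by auto
  fix a
  {
    assume "a \<in> (*\<^sub>R) \<alpha> ` K"
    then obtain x where x: "x \<in> K" "a = \<alpha> *\<^sub>R x" by blast
    obtain y where y: "y \<in> L" "dist x y \<le> hausdorff_dist K L"
      using near_point_hausdorff[of K L x] K L x by metis
    have "infdist a ((*\<^sub>R) \<beta> ` L) \<le> dist a (\<beta> *\<^sub>R y)" using y by (intro infdist_le) auto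
    then show "infdist a ((*\<^sub>R) \<beta> ` L) \<le> \<alpha> * hausdorff_dist K L + 2 * \<bar>\<alpha> - \<beta>\<bar>"
      using *[OF y] x by simp
  next
    assume "a \<in> (*\<^sub>R) \<beta> ` L"
    then obtain y where y: "y \<in> L" "a = \<beta> *\<^sub>R y" by blast
    obtain x where x: "x \<in> K" "dist y x \<le> hausdorff_dist L K"
      using near_point_hausdorff[of L K y] K L y by metis
    have "infdist a ((*\<^sub>R) \<alpha> ` K) \<le> dist a (\<alpha> *\<^sub>R x)" using x by (intro infdist_le) auto
    then show "infdist a ((*\<^sub>R) \<alpha> ` K) \<le> \<alpha> * hausdorff_dist K L + 2 * \<bar>\<alpha> - \<beta>\<bar>"
      using *[of y x] x y by (simp add: dist_commute hausdorff_dist_commute)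
  }
qed

text \<open>Only the second factor of the product is known to be second countable. This suffices:
  for each basic open set \<open>B\<close> of scales, the bodies \<open>K\<close> with a neighbourhood that is mapped
  into \<open>U\<close> by all scales in \<open>B\<close> form an open set.\<close>

lemma measurable_scale_body:
  "scale_body \<in> measurable (hausdorff_borel (sym_bodies1 :: 'a::euclidean_space set set)
      \<Otimes>\<^sub>M restrict_space borel {0<..}) (hausdorff_borel sym_bodies)"
    (is "_ \<in> measurable (?H1 \<Otimes>\<^sub>M ?R) _")
proof -
  interpret S: Metric_space "sym_bodies :: 'a set set" hausdorff_dist
    by (rule Metric_space_sym_bodies)
  interpret S1: Metric_space "sym_bodies1 :: 'a set set" hausdorff_dist
    by (rule Metric_space_sym_bodies1)
  have space: "space (?H1 \<Otimes>\<^sub>M ?R) = sym_bodies1 \<times> {0<..}"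
    by (simp add: space_pair_measure space_restrict_space)
  obtain \<B> :: "real set set" where \<B>: "countable \<B>" "topological_basis \<B>"
    using ex_countable_basis by blast
  show ?thesis
    unfolding hausdorff_borel_def[of sym_bodies]
  proof (rule measurable_measure_of)
    show "{U. openin S.mtopology U} \<subseteq> Pow sym_bodies"
      using openin_subset[of S.mtopology] by auto
    show "scale_body \<in> space (?H1 \<Otimes>\<^sub>M ?R) \<rightarrow> sym_bodies"
      using scale_sym_bodies sym_bodies1_subset by (fastforce simp: space scale_body_def)
  next
    fix U :: "'a set set" assume "U \<in> {U. openin S.mtopology U}"
    then have U: "openin S.mtopology U" by simp
    define V where "V B = \<Union> {N. openin S1.mtopology N \<and>
      (\<forall>K\<in>N. \<forall>\<alpha>\<in>B \<inter> {0<..}. scale_body (K, \<alpha>) \<in> U)}" for B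
    have V: "V B \<in> sets ?H1" for B
      unfolding V_def by (intro openin_in_sets_hausdorff_borel S1.Metric_space_axioms openin_Union) auto
    have "\<exists>B\<in>\<B>. K \<in> V B \<and> \<alpha> \<in> B"
      if K: "K \<in> sym_bodies1" and \<alpha>: "\<alpha> > 0" and KU: "scale_body (K, \<alpha>) \<in> U" for K \<alpha>
    proof -
      obtain r where r: "r > 0" "S.mball (scale_body (K, \<alpha>)) r \<subseteq> U"
        using U KU by (auto simp: S.openin_mtopology)
      \<comment> \<open>With the radii \<open>\<delta>\<close> for bodies and \<open>r / 4\<close>
        for scales, each term of the bound in \<open>hausdorff_dist_scale_le\<close> gets half of
        \<open>r\<close>.\<close>
      define \<delta> where "\<delta> = r / (2 * \<alpha>)"
      obtain B where B: "B \<in> \<B>" "\<alpha> \<in> B" "B \<subseteq> ball \<alpha> (r / 4)"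
        using topological_basisE[OF \<B>(2) open_ball[of \<alpha> "r / 4"], of \<alpha>] r by auto
      have "scale_body (L, \<beta>) \<in> U"
        if L: "L \<in> S1.mball K \<delta>" and \<beta>: "\<beta> \<in> B" "\<beta> > 0" for L \<beta>
      proof -
        have L': "L \<in> sym_bodies1" "hausdorff_dist K L < \<delta>" using L by auto
        have "hausdorff_dist (scale_body (K, \<alpha>)) (scale_body (L, \<beta>))
            \<le> \<alpha> * hausdorff_dist K L + 2 * \<bar>\<alpha> - \<beta>\<bar>"
          unfolding scale_body_def using K L' \<alpha> \<beta> sym_bodies1_subset
          by (auto intro!: hausdorff_dist_scale_le)
        also have "\<dots> < \<alpha> * \<delta> + 2 * (r / 4)"
          using L' \<alpha> \<beta> B by (intro add_strict_mono mult_strict_left_mono) (auto simp: dist_real_def)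
        also have "\<dots> = r" using \<alpha> by (simp add: \<delta>_def)
        finally show ?thesis
          using r K L' \<alpha> \<beta> sym_bodies1_subset
          by (intro subsetD[OF r(2)]) (auto simp: scale_body_def intro!: scale_sym_bodies)
      qed
      then have "K \<in> V B"
        unfolding V_def using K r \<alpha>
        by (intro UnionI[of "S1.mball K \<delta>"]) (auto simp: \<delta>_def)
      then show ?thesis using B by blast
    qed
    moreover have "K \<in> sym_bodies1" if "K \<in> V B" for K B
      using that openin_subset[of S1.mtopology] by (fastforce simp: V_def)
    \<comment> \<open>The preimage becomes a countable union of measurable rectangles, which lies in
      the product sigma-algebra.\<close>
    ultimately have "scale_body -` U \<inter> space (?H1 \<Otimes>\<^sub>M ?R) = (\<Union>B\<in>\<B>. V B \<times> (B \<inter> {0<..}))"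
      unfolding space V_def by auto blast+
    moreover have "B \<inter> {0<..} \<in> sets ?R" if "B \<in> \<B>" for B
      using topological_basis_open[OF \<B>(2) that] by (auto simp: sets_restrict_space)
    ultimately show "scale_body -` U \<inter> space (?H1 \<Otimes>\<^sub>M ?R) \<in> sets (?H1 \<Otimes>\<^sub>M ?R)"
      using \<B>(1) V by auto
  qed
qed

section \<open>The truncated normal distribution\<close>

text \<open>Standardising carries the interval to \<open>{0..(c - \<mu>) / s}\<close>. A difference
  of \<open>cdf\<close> values measures the interval without its left endpoint, which is a null
  set.\<close>

lemma measure_normal_interval:
  assumes s: "s > 0" and c: "\<mu> \<le> c"
  shows "measure (density lborel (normal_density \<mu> s)) {\<mu>..c}
    = std_normal_cdf ((c - \<mu>) / s) - std_normal_cdf 0"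
proof -
  let ?N = "density lborel (normal_density \<mu> s)"
  interpret N: prob_space ?N by (rule prob_space_normal_density[OF s])
  interpret std: real_distribution std_normal_distribution by (rule real_dist_normal_dist)
  have "distributed ?N lborel (\<lambda>x. x) (normal_density \<mu> s)"
    by (simp add: distributed_def distr_id2)
  then have "distributed ?N lborel (\<lambda>x. (x - \<mu>) / s) std_normal_density"
    by (subst (asm) N.normal_standard_normal_convert[OF s]) simp
  then have D: "distr ?N lborel (\<lambda>x. (x - \<mu>) / s) = std_normal_distribution"
    by (simp add: distributed_def)
  have pt: "measure std_normal_distribution {x} = 0" for x
    by (simp add: measure_def emeasure_density nn_integral_indicator_singleton)
  have "measure ?N {\<mu>..c} = measure (distr ?N lborel (\<lambda>x. (x - \<mu>) / s)) {0..(c - \<mu>) / s}"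
    using s by (subst measure_distr) (auto intro!: arg_cong[where f = "measure ?N"] simp: field_simps)
  also have "\<dots> = measure std_normal_distribution {0..(c - \<mu>) / s}" unfolding D ..
  also have "\<dots> = std_normal_cdf ((c - \<mu>) / s) - std_normal_cdf 0"
  \<comment> \<open>\<open>cdf_diff_eq\<close> requires a strict inequality, so the degenerate
    interval is treated separately.\<close>
  proof (cases "c = \<mu>")
    case False
    then have pos: "0 < (c - \<mu>) / s" using s c by simp
    then have "{0..(c - \<mu>) / s} = {0} \<union> {0<..(c - \<mu>) / s}" by auto
    then have "measure std_normal_distribution {0..(c - \<mu>) / s}
        = measure std_normal_distribution {0} + measure std_normal_distribution {0<..(c - \<mu>) / s}"
      by (simp only:) (rule std.finite_measure_Union; simp)
    then show ?thesis using std.cdf_diff_eq[OF pos] pt by simp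
  qed (simp add: pt)
  finally show ?thesis .
qed

lemma AE_normal_neq: "AE x in density lborel (normal_density \<mu> s). x \<noteq> c"
  using AE_lborel_singleton[of c] by (subst AE_density) (auto elim: eventually_mono)

lemma emeasure_normal_atLeastLessThan:
  assumes s: "s > 0" and c: "\<mu> \<le> c"
  shows "emeasure (density lborel (normal_density \<mu> s)) {\<mu>..<c}
    = ennreal (std_normal_cdf ((c - \<mu>) / s) - std_normal_cdf 0)"
proof -
  let ?N = "density lborel (normal_density \<mu> s)"
  interpret N: prob_space ?N by (rule prob_space_normal_density[OF s])
  from AE_normal_neq[of c] have "AE x in ?N. x \<in> {\<mu>..<c} \<longleftrightarrow> x \<in> {\<mu>..c}"
    by eventually_elim auto
  then have "emeasure ?N {\<mu>..<c} = emeasure ?N {\<mu>..c}"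
    by (intro emeasure_eq_AE) auto
  then show ?thesis using measure_normal_interval[OF assms] by (simp add: N.emeasure_eq_measure)
qed

text \<open>If the interval from 0 to \<open>c\<close> had mass 0, the density would vanish almost
  everywhere on it. But the density is positive and the interval has length
  \<open>c > 0\<close>.\<close>

lemma std_normal_cdf_strict:
  assumes "c > 0"
  shows "std_normal_cdf 0 < std_normal_cdf c"
proof -
  interpret std: real_distribution std_normal_distribution by (rule real_dist_normal_dist)
  have "emeasure std_normal_distribution {0<..c} \<noteq> 0"
  proof
    assume "emeasure std_normal_distribution {0<..c} = 0"
    then have "AE x in lborel. ennreal (std_normal_density x) * indicator {0<..c} x = 0"
      by (simp add: emeasure_density nn_integral_0_iff_AE)
    then have "AE x in lborel. x \<notin> {0<..c}"
      by eventually_elim (auto simp: ennreal_eq_0_iff indicator_def normal_density_pos simp flip: not_less)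
    then have "emeasure lborel {0<..c} = 0"
      by (subst (asm) AE_iff_measurable[of "{0<..c}"]) auto
    then show False using assms by simp
  qed
  then show ?thesis
    using std.cdf_diff_eq[OF assms] measure_nonneg[of std_normal_distribution "{0<..c}"]
    by (simp add: std.emeasure_eq_measure del: measure_nonneg)
qed

text \<open>Passing to mean 1/2 and standard deviation \<open>\<sigma>/2\<close> leaves the exponent
  unchanged and doubles the prefactor \<open>1 / sqrt (2 * pi * \<sigma>\<^sup>2)\<close>. This 2 is
  the density of the uniform law, and the normalising constants agree as well.\<close>

lemma density_uniform_eq_truncated_normal:
  assumes \<sigma>: "\<sigma> > 0"
  shows "density (uniform_measure lborel {1/2..<1})
      (\<lambda>t. ennreal (1 / ((std_normal_cdf (1 / \<sigma>) - std_normal_cdf 0) * sqrt (2 * pi * \<sigma>\<^sup>2)) *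
        exp (- (2 * t - 1)\<^sup>2 / (2 * \<sigma>\<^sup>2))))
    = truncated_normal (1/2) (\<sigma>/2) {1/2..<1}"
proof -
  define Z where "Z = std_normal_cdf (1 / \<sigma>) - std_normal_cdf 0"
  have Z: "Z > 0" using std_normal_cdf_strict[of "1 / \<sigma>"] \<sigma> by (simp add: Z_def)
  \<comment> \<open>The right endpoint standardises to
    \<open>(1 - 1/2) / (\<sigma>/2) = 1 / \<sigma>\<close>, so \<open>Z\<close> is the normal mass
    of the interval.\<close>
  have N: "emeasure (density lborel (normal_density (1/2) (\<sigma>/2))) {1/2..<1} = ennreal Z"
    using emeasure_normal_atLeastLessThan[of "\<sigma>/2" "1/2" 1] \<sigma> by (simp add: Z_def)
  have U: "emeasure lborel {1/2..<1::real} = ennreal (1/2)" by simp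
  have sq: "sqrt (2 * pi * (\<sigma>/2)\<^sup>2) = sqrt (2 * pi * \<sigma>\<^sup>2) / 2"
    using \<sigma> by (simp add: real_sqrt_mult)
  have ex: "(2 * t - 1)\<^sup>2 / (2 * \<sigma>\<^sup>2) = (t - 1/2)\<^sup>2 / (2 * (\<sigma>/2)\<^sup>2)" for t
    using \<sigma> by (simp add: field_simps power2_eq_square)
  have nd: "normal_density (1/2) (\<sigma>/2) t
      = 2 * (1 / sqrt (2 * pi * \<sigma>\<^sup>2) * exp (- (2 * t - 1)\<^sup>2 / (2 * \<sigma>\<^sup>2)))" for t
    unfolding normal_density_def sq using ex[of t] by simp
  have eq: "indicator {1/2..<1} t / ennreal (1/2) *
        ennreal (1 / (Z * sqrt (2 * pi * \<sigma>\<^sup>2)) * exp (- (2 * t - 1)\<^sup>2 / (2 * \<sigma>\<^sup>2)))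
      = ennreal (normal_density (1/2) (\<sigma>/2) t) * (indicator {1/2..<1} t / ennreal Z)" for t :: real
  proof (cases "t \<in> {1/2..<1}")
    case True
    have "1 / ennreal (1/2) = ennreal 2" "1 / ennreal Z = ennreal (1 / Z)"
      using Z divide_ennreal[of 1 "1/2"] divide_ennreal[of 1 Z] by (simp_all del: ennreal_half)
    moreover have "ennreal 2 * ennreal a = ennreal (2 * a)" for a
      by (rule ennreal_mult'[symmetric]) simp
    ultimately show ?thesis
      using True Z by (simp add: nd ennreal_mult[symmetric] field_simps del: ennreal_half ennreal_numeral)
  qed simp
  have "density (uniform_measure lborel {1/2..<1})
        (\<lambda>t. ennreal (1 / (Z * sqrt (2 * pi * \<sigma>\<^sup>2)) * exp (- (2 * t - 1)\<^sup>2 / (2 * \<sigma>\<^sup>2))))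
      = density lborel (\<lambda>t. indicator {1/2..<1} t / ennreal (1/2) *
          ennreal (1 / (Z * sqrt (2 * pi * \<sigma>\<^sup>2)) * exp (- (2 * t - 1)\<^sup>2 / (2 * \<sigma>\<^sup>2))))"
    unfolding uniform_measure_def U by (rule density_density_eq) measurable
  also have "\<dots> = truncated_normal (1/2) (\<sigma>/2) {1/2..<1}"
    unfolding truncated_normal_def uniform_measure_def N eq
    by (rule density_density_eq[symmetric]) measurable
  finally show ?thesis by (simp only: Z_def)
qed

section \<open>The reweighted measure and its image under thinness\<close>

theorem theorem2:
  fixes \<sigma> :: real
    and \<nu>\<^sub>0\<^sub>1 \<nu>\<^sub>0 :: "'a::euclidean_space set measure"
    and \<nu> :: "real measure"
  assumes "\<sigma> > 0"
    and "prob_space \<nu>\<^sub>0\<^sub>1"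
    and "sets \<nu>\<^sub>0\<^sub>1 = sets (hausdorff_borel (sym_bodies1 :: 'a set set))"
    and "distr \<nu>\<^sub>0\<^sub>1 borel thinness = uniform_measure lborel {1/2..<1}"
    and "prob_space \<nu>"
    and "sets \<nu> = sets (restrict_space borel {0<..})"
    and "\<nu>\<^sub>0 = distr (\<nu>\<^sub>0\<^sub>1 \<Otimes>\<^sub>M \<nu>) (hausdorff_borel sym_bodies) scale_body"
  shows "prob_space (thin_measure \<sigma> \<nu>\<^sub>0) \<and>
    space (thin_measure \<sigma> \<nu>\<^sub>0) = sym_bodies \<and>
    sets (thin_measure \<sigma> \<nu>\<^sub>0) = sets \<nu>\<^sub>0 \<and>
    (\<forall>\<A> \<in> sets \<nu>\<^sub>0.
       measure (thin_measure \<sigma> \<nu>\<^sub>0) \<A> = thin_P \<sigma> \<nu>\<^sub>0 \<A> \<and>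
       thin_P \<sigma> \<nu>\<^sub>0 \<A> =
         1 / ((std_normal_cdf (1 / \<sigma>) - std_normal_cdf 0) * sqrt (2 * pi * \<sigma>\<^sup>2)) *
         (LINT K:\<A>|\<nu>\<^sub>0. exp (- (hausdorff_dist (cball 0 1)
            (scale_body (K, thinness K / body_scale K)))\<^sup>2 / (2 * \<sigma>\<^sup>2)))) \<and>
    distr (thin_measure \<sigma> \<nu>\<^sub>0) borel thinness = truncated_normal (1/2) (\<sigma>/2) {1/2..<1} \<and>
    (\<forall>c \<in> {1/2..1}.
       measure (distr (thin_measure \<sigma> \<nu>\<^sub>0) borel thinness) {1/2..c} =
         measure (thin_measure \<sigma> \<nu>\<^sub>0) {K \<in> sym_bodies. thinness K \<le> c} \<and>
       measure (thin_measure \<sigma> \<nu>\<^sub>0) {K \<in> sym_bodies. thinness K \<le> c} =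
         (std_normal_cdf ((c - 1/2) / (\<sigma>/2)) - std_normal_cdf 0) /
         (std_normal_cdf (1 / \<sigma>) - std_normal_cdf 0))"
proof -
  define Z where "Z = std_normal_cdf (1 / \<sigma>) - std_normal_cdf 0"
  define C where "C = 1 / (Z * sqrt (2 * pi * \<sigma>\<^sup>2))"
  define f where "f t = exp (- (2 * t - 1)\<^sup>2 / (2 * \<sigma>\<^sup>2))" for t :: real
  have Z: "Z > 0" using std_normal_cdf_strict[of "1 / \<sigma>"] assms(1) by (simp add: Z_def)
  then have C: "C \<ge> 0" by (simp add: C_def)
  have [measurable]: "f \<in> borel_measurable borel" unfolding f_def by measurable
  have f_bounds: "0 \<le> f t" "f t \<le> 1" for t by (auto simp: f_def)
  let ?T = "thinness :: 'a set \<Rightarrow> real"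
  interpret N1: prob_space \<nu>\<^sub>0\<^sub>1 by fact
  interpret N: prob_space \<nu> by fact
  interpret pair_prob_space \<nu>\<^sub>0\<^sub>1 \<nu> ..
  note [measurable_cong] = assms(3,6)
  have [measurable]: "scale_body \<in> measurable (\<nu>\<^sub>0\<^sub>1 \<Otimes>\<^sub>M \<nu>) (hausdorff_borel sym_bodies)"
    using measurable_scale_body by measurable
  have space1: "space \<nu>\<^sub>0\<^sub>1 = sym_bodies1"
    using sets_eq_imp_space_eq[OF assms(3)] by simp
  have space\<nu>: "space \<nu> = {0<..}"
    using sets_eq_imp_space_eq[OF assms(6)] by (simp add: space_restrict_space)
  have sets0 [measurable_cong]: "sets \<nu>\<^sub>0 = sets (hausdorff_borel sym_bodies)"
    and space0: "space \<nu>\<^sub>0 = sym_bodies"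
    by (simp_all add: assms(7))
  interpret N0: prob_space \<nu>\<^sub>0 unfolding assms(7) by (rule prob_space_distr) measurable
  have [measurable]: "?T \<in> borel_measurable (hausdorff_borel sym_bodies)"
    "?T \<in> borel_measurable (hausdorff_borel sym_bodies1)"
    by (auto intro!: borel_measurable_thinness sym_bodies1_subset)
  \<comment> \<open>All scales in the product space are positive, so the thinness of the scaled body
    depends only on the first factor, where its law is uniform by hypothesis.\<close>
  have "distr \<nu>\<^sub>0 borel ?T = distr (\<nu>\<^sub>0\<^sub>1 \<Otimes>\<^sub>M \<nu>) borel (?T \<circ> scale_body)"
    unfolding assms(7) by (rule distr_distr) measurable
  also have "\<dots> = distr (\<nu>\<^sub>0\<^sub>1 \<Otimes>\<^sub>M \<nu>) borel (?T \<circ> fst)"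
    using sym_bodies1_subset
    by (intro distr_cong) (auto simp: space_pair_measure space1 space\<nu> scale_body_def intro!: thinness_scale)
  also have "\<dots> = distr (distr (\<nu>\<^sub>0\<^sub>1 \<Otimes>\<^sub>M \<nu>) \<nu>\<^sub>0\<^sub>1 fst) borel ?T"
    by (rule distr_distr[symmetric]) measurable
  also have "\<dots> = uniform_measure lborel {1/2..<1}"
    unfolding N.distr_pair_fst by (rule assms(4))
  finally have unif: "distr \<nu>\<^sub>0 borel ?T = uniform_measure lborel {1/2..<1}" .
  \<comment> \<open>A density with respect to \<open>\<nu>\<^sub>0\<close> is countably additive by
    construction. Identifying \<open>thin_measure\<close> with \<open>D\<close> thus shows that
    \<open>measure_of\<close> does not fall back to the zero measure.\<close>
  define D where "D = density \<nu>\<^sub>0 (\<lambda>K. ennreal (C * f (?T K)))"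
  have D_distr: "distr D borel ?T = truncated_normal (1/2) (\<sigma>/2) {1/2..<1}"
  proof -
    have "distr D borel ?T = density (distr \<nu>\<^sub>0 borel ?T) (\<lambda>t. ennreal (C * f t))"
      unfolding D_def by (rule density_distr[symmetric]) measurable
    then show ?thesis
      unfolding unif C_def f_def Z_def density_uniform_eq_truncated_normal[OF assms(1)] .
  qed
  have thin_P_eq: "thin_P \<sigma> \<nu>\<^sub>0 \<A> = C * (LINT K:\<A>|\<nu>\<^sub>0. exp (- (hausdorff_dist (cball 0 1)
            (scale_body (K, thinness K / body_scale K)))\<^sup>2 / (2 * \<sigma>\<^sup>2)))" for \<A>
    by (simp add: thin_P_def thin_p_def C_def Z_def)
  have emeasure_D: "emeasure D \<A> = ennreal (thin_P \<sigma> \<nu>\<^sub>0 \<A>)" if [measurable]: "\<A> \<in> sets \<nu>\<^sub>0" for \<A>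
  proof -
    have "emeasure D \<A> = (\<integral>\<^sup>+ K. ennreal (C * (indicator \<A> K * f (?T K))) \<partial>\<nu>\<^sub>0)"
      unfolding D_def by (subst emeasure_density) (auto intro!: nn_integral_cong split: split_indicator)
    also have "\<dots> = ennreal (\<integral> K. C * (indicator \<A> K * f (?T K)) \<partial>\<nu>\<^sub>0)"
      using C f_bounds
      by (intro nn_integral_eq_integral integrable_mult_right N0.integrable_const_bound[of _ 1])
        (auto split: split_indicator)
    also have "(\<integral> K. C * (indicator \<A> K * f (?T K)) \<partial>\<nu>\<^sub>0)
        = C * (LINT K:\<A>|\<nu>\<^sub>0. f (?T K))"
      by (simp add: set_lebesgue_integral_def)
    \<comment> \<open>The formula for the distance holds on \<open>sym_bodies\<close>, which is the
      whole space of \<open>\<nu>\<^sub>0\<close>.\<close>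
    also have "(LINT K:\<A>|\<nu>\<^sub>0. f (?T K)) = (LINT K:\<A>|\<nu>\<^sub>0. exp (- (hausdorff_dist (cball 0 1)
            (scale_body (K, thinness K / body_scale K)))\<^sup>2 / (2 * \<sigma>\<^sup>2)))"
      unfolding set_lebesgue_integral_def
      by (intro Bochner_Integration.integral_cong)
        (simp_all add: space0 hausdorff_dist_cball_normalized f_def)
    finally show ?thesis by (simp add: thin_P_eq)
  qed
  have D_eq: "thin_measure \<sigma> \<nu>\<^sub>0 = D"
  proof -
    \<comment> \<open>\<open>measure_of\<close> depends only on the values on measurable sets, where
      \<open>emeasure_D\<close> applies.\<close>
    have "thin_measure \<sigma> \<nu>\<^sub>0 = measure_of (space \<nu>\<^sub>0) (sets \<nu>\<^sub>0) (emeasure D)"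
      unfolding thin_measure_def
      by (rule measure_of_eq) (auto simp: sets.space_closed sets.sigma_sets_eq emeasure_D)
    also have "\<dots> = D" using measure_of_of_measure[of D] by (simp add: D_def)
    finally show ?thesis .
  qed
  have sets_D [measurable_cong]: "sets D = sets \<nu>\<^sub>0" and space_D: "space D = sym_bodies"
    by (simp_all add: D_def space0)
  \<comment> \<open>\<open>ennreal\<close> sends negative reals to 0, so nonnegativity is what
    allows the real value of \<open>thin_P\<close> to be read off from
    \<open>emeasure_D\<close>.\<close>
  have thin_P_nonneg: "thin_P \<sigma> \<nu>\<^sub>0 \<A> \<ge> 0" for \<A>
    unfolding thin_P_eq set_lebesgue_integral_def
    using C by (auto intro!: mult_nonneg_nonneg integral_nonneg_AE)
  let ?N = "density lborel (normal_density (1/2) (\<sigma>/2))"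
  have mN: "emeasure ?N {1/2..<1} = ennreal Z"
    using emeasure_normal_atLeastLessThan[of "\<sigma>/2" "1/2" 1] assms(1) by (simp add: Z_def)
  have tn: "emeasure (truncated_normal (1/2) (\<sigma>/2) {1/2..<1}) B = emeasure ?N ({1/2..<1} \<inter> B) / ennreal Z"
    if "B \<in> sets borel" for B
    using that by (simp add: truncated_normal_def mN)
  have "prob_space (truncated_normal (1/2) (\<sigma>/2) {1/2..<1})"
    unfolding truncated_normal_def using Z by (intro prob_space_uniform_measure) (auto simp: mN)
  \<comment> \<open>\<open>D\<close> has total mass 1 because its image under thinness has.\<close>
  then have "prob_space D"
    unfolding D_distr[symmetric] by (rule prob_space_distrD[rotated]) measurable
  \<comment> \<open>Thinness is at least 1/2 on every body, so the preimage of the interval is the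
    sublevel set.\<close>
  moreover have "measure (distr D borel ?T) {1/2..c} = measure D {K \<in> sym_bodies. thinness K \<le> c}" for c
    using thinness_bounds
    by (subst measure_distr) (auto simp: space_D intro!: arg_cong[where f = "measure D"])
  moreover have "measure (distr D borel ?T) {1/2..c} = (std_normal_cdf ((c - 1/2) / (\<sigma>/2)) - std_normal_cdf 0) / Z"
    if c: "c \<in> {1/2..1}" for c
  proof -
    interpret N': prob_space ?N using assms(1) by (intro prob_space_normal_density) simp
    \<comment> \<open>For \<open>c = 1\<close> the truncation interval lacks the endpoint 1, which
      is a null set of the normal law.\<close>
    have "x \<in> {1/2..<1} \<inter> {1/2..c} \<longleftrightarrow> x \<in> {1/2..c}" if "x \<noteq> 1" for x :: real
      using that c by auto
    then have "AE x in ?N. x \<in> {1/2..<1} \<inter> {1/2..c} \<longleftrightarrow> x \<in> {1/2..c}"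
      by (rule eventually_mono[OF AE_normal_neq[of 1]])
    then have "measure ?N ({1/2..<1} \<inter> {1/2..c}) = measure ?N {1/2..c}"
      by (intro measure_eq_AE) auto
    moreover have "measure (truncated_normal (1/2) (\<sigma>/2) {1/2..<1}) {1/2..c}
        = measure ?N ({1/2..<1} \<inter> {1/2..c}) / Z"
      by (rule measure_eq_emeasure_eq_ennreal)
        (use tn[of "{1/2..c}"] Z in \<open>simp_all add: N'.emeasure_eq_measure divide_ennreal\<close>)
    ultimately show ?thesis
      unfolding D_distr using measure_normal_interval[of "\<sigma>/2" "1/2" c] assms(1) c by simp
  qed
  moreover have "measure D \<A> = thin_P \<sigma> \<nu>\<^sub>0 \<A>" if "\<A> \<in> sets \<nu>\<^sub>0" for \<A>
    by (intro measure_eq_emeasure_eq_ennreal thin_P_nonneg emeasure_D that)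
  ultimately show ?thesis
    unfolding D_eq using D_distr thin_P_eq
    by (simp add: sets_D space_D C_def flip: Z_def)
qed

end
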